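(* Let $b\geq 2$ be an integer. The set $T_b$ of Trott numbers in base $b$ is nonempty if and only if $$b\in\Gamma:=\{3\}\cup\bigcup_{k=1}^\infty \{k^2+1,k^2+2,\dots,k^2+k\}.$$ Furthermore, if $T_b$ is nonempty, then it is uncountable.
   Context: Let $b\geq 2$ be an integer. A real number $x$ is a Trott number in base $b$ if $x\in(0,1)$ has an infinite continued fraction expansion $x=[0;a_1,a_2,a_3,\dots]$ with all $a_i$ positive integers, and the base-$b$ expansion of $x$ is $x=(0.\hat{a}_1\hat{a}_2\hat{a}_3\dots)_b$, where $\hat{a}_i$ denotes the string of base-$b$ digits of $a_i$ (without leading zeros) and the strings are concatenated. $T_b$ denotes the set of Trott numbers in base $b$. *)

theory Defs
  imports Complex_Main "HOL-Library.Countable_Set"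
begin

text \<open>
  Sequences are indexed from 0, so the partial quotient written $a_i$ on paper ($i \ge 1$) is
  \<open>a (i - 1)\<close> here.
\<close>

text \<open>\<open>cf_convergent a n\<close> is the finite continued fraction $[0; a_1, \dots, a_n]$.\<close>

primrec cf_convergent :: "(nat \<Rightarrow> nat) \<Rightarrow> nat \<Rightarrow> real" where
  "cf_convergent a 0 = 0"
| "cf_convergent a (Suc n) = 1 / (real (a 0) + cf_convergent (\<lambda>i. a (Suc i)) n)"

definition is_cf_expansion :: "(nat \<Rightarrow> nat) \<Rightarrow> real \<Rightarrow> bool" where
  "is_cf_expansion a x \<longleftrightarrow> (\<forall>i. a i > 0) \<and> cf_convergent a \<longlonglongrightarrow> x"

text \<open>
  Digits come most significant first, without leading zeros (the digit string of 0 is empty).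
  The guard \<open>b < 2\<close> only serves totality.
\<close>

fun base_digits :: "nat \<Rightarrow> nat \<Rightarrow> nat list" where
  "base_digits b n =
     (if b < 2 \<or> n = 0 then [] else base_digits b (n div b) @ [n mod b])"

declare base_digits.simps [simp del]

text \<open>
  The \<open>k\<close>-th digit of the infinite concatenation of the digit strings of
  \<open>a 0\<close>, \<open>a 1\<close>, \<open>\<dots>\<close>. For positive \<open>a i\<close> and \<open>b \<ge> 2\<close> every string is nonempty, so the first
  \<open>k + 1\<close> strings already contain position \<open>k\<close>.
\<close>

definition concat_digit :: "nat \<Rightarrow> (nat \<Rightarrow> nat) \<Rightarrow> nat \<Rightarrow> nat" where
  "concat_digit b a k = concat (map (\<lambda>i. base_digits b (a i)) [0..<Suc k]) ! k"

text \<open>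
  $x = (0.d_1 d_2 d_3 \dots)_b$. No convention about trailing digits \<open>b - 1\<close> is imposed: it would
  only matter for rational \<open>x\<close>, whereas numbers with an infinite continued fraction are irrational.
\<close>

definition is_base_expansion :: "nat \<Rightarrow> (nat \<Rightarrow> nat) \<Rightarrow> real \<Rightarrow> bool" where
  "is_base_expansion b d x \<longleftrightarrow>
     (\<forall>k. d k < b) \<and> (\<lambda>k. real (d k) / real b ^ Suc k) sums x"

definition trott_numbers :: "nat \<Rightarrow> real set" where
  "trott_numbers b =
     {x \<in> {0<..<1}. \<exists>a. is_cf_expansion a x \<and> is_base_expansion b (concat_digit b a) x}"

definition Gamma_set :: "nat set" where
  "Gamma_set = {3} \<union> (\<Union>k\<in>{1..}. {k\<^sup>2 + 1..k\<^sup>2 + k})"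

end

theory Submission
  imports Defs "HOL-Number_Theory.Number_Theory" "HOL-Real_Asymp.Real_Asymp"
begin

text \<open>
  For a prefix $a_1, \dots, a_n$ with convergents $p/q$, $p'/q'$ and digit string of length $L$
  and integer value $e$, put $y = b^L p/q - e$, the position of $p/q$ in the base-$b$ cylinder.
  If $1/b < y < 1$ and $y$ has a purely periodic base-$b$ expansion, then for every large multiple
  $N$ of the period the integer $m = (b^N - 1) y$, given by
  the first $N$ digits of $y$, is an admissible next quotient. The new position is $y \pm b^{L+N}/(q (m q + q'))$, which is as close
  as desired to $y \pm b^L/(q^2 y)$, and the new denominator is $b^N q y - (q y - q')$, whose common
  part with powers of $b$ is bounded, so the new position is again purely periodic. Hence every
  good prefix can be continued in infinitely many ways at every step, and a diagonal argument gives
  uncountably many Trott numbers.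

  For $b = k^2 + j$ with $1 \le j \le k$ a good prefix is $k, m$ with $m$ close to $j b^N / k$,
  and for $b = 3$ it is $1, 1, 125$. Conversely, writing $x = (k + y)/b = 1/(k + z)$ gives
  $(k + y)(k + z) = b$, so $k^2 < b$, and estimating $y$ and $z$ through the second quotient
  yields $b \le k^2 + k$ or $b = 3$.
\<close>

subsection \<open>Extending a good state\<close>

text \<open>Stripping \<open>gcd D b\<close> repeatedly leaves a cofactor coprime to
  \<open>b\<close>. Each stripped factor divides \<open>b\<close> and makes \<open>D\<close>
  smaller, so there are at most \<open>D\<close> rounds; the exponent \<open>D\<close> is crude but
  sufficient.\<close>

lemma coprime_part:
  fixes b D :: nat
  assumes "D > 0"
  shows "\<exists>g D'. D = g * D' \<and> coprime D' b \<and> g dvd b ^ D"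
  using assms
proof (induction D rule: less_induct)
  case (less D)
  show ?case
  proof (cases "coprime D b")
    case True
    then have "D = 1 * D \<and> coprime D b \<and> 1 dvd b ^ D" by simp
    then show ?thesis by blast
  next
    case False
    define h where "h = gcd D b"
    have "h \<noteq> 1" using False unfolding h_def coprime_iff_gcd_eq_1 .
    moreover have "h > 0" using less.prems by (simp add: h_def)
    moreover have "h dvd D" "h dvd b" by (simp_all add: h_def)
    ultimately have h: "h > 1" "h dvd D" "h dvd b" by linarith+
    define E where "E = D div h"
    have E1: "D = h * E" using h by (simp add: E_def)
    moreover have "E > 0" using E1 less.prems by (auto intro: Nat.gr0I)
    moreover have "E < D" using less.prems h(1) unfolding E_def by simp
    ultimately have E: "D = h * E" "E > 0" "E < D" by blast+
    obtain g D' where g: "E = g * D'" "coprime D' b" "g dvd b ^ E"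
      using less.IH[OF E(3,2)] by blast
    have "h * g dvd b ^ Suc E"
      using g(3) h(3) by (simp add: mult_dvd_mono)
    also have "b ^ Suc E dvd b ^ D"
      using E(3) by (intro le_imp_power_dvd) auto
    finally have "D = (h * g) * D' \<and> coprime D' b \<and> h * g dvd b ^ D"
      using g E(1) by (simp add: mult.assoc)
    then show ?thesis by blast
  qed
qed

text \<open>The part \<open>g\<close> that \<open>D\<close> shares with powers of \<open>b\<close>
  splits off, giving \<open>Q = g * R\<close> with \<open>R\<close> congruent to \<open>- E\<close>
  modulo \<open>b\<close>. So \<open>R\<close> is coprime to \<open>b\<close> and divides some
  \<open>b ^ P - 1\<close> by Euler's theorem, while \<open>g\<close> divides \<open>b ^ M\<close>.
  Denominators of extended prefixes have the shape of \<open>Q\<close>.\<close>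

lemma periodic_of_power_minus:
  fixes b :: nat and X D Q :: int
  assumes "b \<ge> 2" "D > 0" "Q > 0" "Q = int b ^ N * X - D" "int N > D" "N \<le> M"
  shows "\<exists>P>0. Q dvd (int b ^ P - 1) * int b ^ M"
proof -
  obtain g E where gE: "nat D = g * E" "coprime E b" "g dvd b ^ nat D"
    using coprime_part[of "nat D" b] assms(2) by auto
  have D: "D = int g * int E" using gE(1) assms(2)
    by (metis int_nat_eq less_le_not_le of_nat_mult)
  \<comment> \<open>One factor \<open>b\<close> is held back; it stays in the first term of
    \<open>R\<close> and makes \<open>R\<close> coprime to \<open>b\<close>.\<close>
  have "g dvd b ^ (N - 1)"
    using gE(3) assms(5) by (rule_tac dvd_trans[OF _ le_imp_power_dvd]) auto
  then obtain h where h: "b ^ (N - 1) = g * h" by blast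
  have bN: "int b ^ N = int g * (int h * int b)"
  proof -
    have "N = Suc (N - 1)" using assms(2,5) by auto
    then have "b ^ N = g * (h * b)" using h by (metis mult.assoc power_Suc2)
    then show ?thesis by (metis of_nat_mult of_nat_power)
  qed
  define R where "R = int h * int b * X - int E"
  have Q: "Q = int g * R" unfolding assms(4) R_def bN D by (simp add: algebra_simps)
  have "g > 0" using gE(1) assms(2) by (auto intro: Nat.gr0I)
  then have R: "R > 0" using Q assms(3) by (simp add: zero_less_mult_iff)
  have "coprime (int E) (int b)" using gE(2) by simp
  then have "coprime R (int b)"
  proof (rule coprime_imp_coprime)
    fix c assume c: "\<not> is_unit c" "c dvd R" "c dvd int b"
    have "c dvd int h * int b * X - R" using c by (intro dvd_diff) auto
    then show "c dvd int E" by (simp add: R_def)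
  qed auto
  then have cop: "coprime b (nat R)"
    using R by (metis coprime_commute coprime_int_iff int_nat_eq less_imp_le)
  have "[b ^ totient (nat R) = 1] (mod nat R)" by (rule euler_theorem[OF cop])
  then have "[int b ^ totient (nat R) = 1] (mod R)"
    using R by (metis cong_int_iff int_nat_eq less_imp_le of_nat_1 of_nat_power)
  then have RP: "R dvd int b ^ totient (nat R) - 1" by (simp add: cong_iff_dvd_diff)
  have "int g dvd int b ^ N" using bN by simp
  then have gM: "int g dvd int b ^ M" using assms(6) by (meson dvd_trans le_imp_power_dvd)
  show ?thesis
    using mult_dvd_mono[OF RP gM] R Q
    by (intro exI[of _ "totient (nat R)"]) (auto simp: mult.commute)
qed

text \<open>
  \<open>y\<close> is the position of \<open>p / q\<close> in the digit cylinder, and \<open>z\<close> is the limit of the next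
  position as the next quotient tends to infinity; \<open>s\<close> is the sign of the step from \<open>p / q\<close> to the
  next convergent. The divisibility says that \<open>y = X / q\<close> has a purely periodic expansion.
\<close>

definition good_state :: "nat \<Rightarrow> int \<Rightarrow> int \<Rightarrow> int \<Rightarrow> int \<Rightarrow> int \<Rightarrow> nat \<Rightarrow> bool" where
  "good_state b p p' q q' e L \<longleftrightarrow>
     (let X = int b ^ L * p - e * q; s = p' * q - p * q';
          y = of_int X / of_int q :: real;
          z = y + of_int s * real b ^ L / (of_int q * of_int X)
      in \<bar>s\<bar> = 1 \<and> 0 \<le> q' \<and> q' < X \<and> 1 / b < y \<and> y < 1 \<and> 1 / b < z \<and> z < 1 \<and>
         (\<exists>P>0. q dvd (int b ^ P - 1) * X))"

text \<open>Both the new position and its own limit position tend to \<open>z\<close>, which lies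
  strictly between \<open>1 / b\<close> and \<open>1\<close>. Hence all strict inequalities hold
  once \<open>N\<close> is a large multiple of the period \<open>P\<close>.\<close>

lemma good_state_extend:
  fixes b :: nat
  assumes b: "b \<ge> 2" and good: "good_state b p p' q q' e L"
  shows "\<exists>m N. c < m \<and> 0 < N \<and> b ^ (N - 1) \<le> m \<and> m < b ^ N \<and>
           good_state b (int m * p + p') p (int m * q + q') q (e * int b ^ N + int m) (L + N)"
proof -
  define X where "X = int b ^ L * p - e * q"
  define s where "s = p' * q - p * q'"
  define y :: real where "y = of_int X / of_int q"
  define z where "z = y + of_int s * real b ^ L / (of_int q * of_int X)"
  obtain P where s: "\<bar>s\<bar> = 1" and q': "0 \<le> q'" "q' < X"
    and y: "1 / b < y" "y < 1" and z: "1 / b < z" "z < 1"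
    and P: "P > 0" "q dvd (int b ^ P - 1) * X"
    using good unfolding good_state_def Let_def X_def s_def y_def z_def by blast
  have X: "X > 0" using q' by simp
  have y0: "y > 0" using y(1) b by (smt (verit) divide_nonneg_nonneg of_nat_0_le_iff)
  have q: "q > 0" using y0 X unfolding y_def by (simp add: zero_less_divide_iff)
  define K where "K = real b ^ L"
  \<comment> \<open>For \<open>B = b ^ N\<close>, \<open>Q B\<close> is the new denominator,
    \<open>f B\<close> the new position and \<open>h B\<close> the new limit position. A real
    argument \<open>B\<close> allows limits at infinity.\<close>
  define Q where "Q = (\<lambda>B::real. (B - 1) * of_int X + of_int q')"
  define f where "f = (\<lambda>B::real. y + of_int s * K * B / (of_int q * Q B))"
  define h where "h = (\<lambda>B::real. f B - of_int s * K * B / ((Q B)\<^sup>2 * f B))"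
  have Xr: "real_of_int X > 0" and qr: "real_of_int q > 0" using X q by auto
  have fz: "(f \<longlongrightarrow> z) at_top"
  proof -
    have "((\<lambda>B::real. B / Q B) \<longlongrightarrow> 1 / of_int X) at_top"
      unfolding Q_def using Xr by (real_asymp simp: field_simps)
    then have "((\<lambda>B. y + of_int s * K / of_int q * (B / Q B)) \<longlongrightarrow>
                 y + of_int s * K / of_int q * (1 / of_int X)) at_top"
      by (rule tendsto_add[OF tendsto_const tendsto_mult[OF tendsto_const]])
    then show ?thesis by (simp add: f_def z_def K_def)
  qed
  have z0: "z \<noteq> 0" using z b by (smt (verit) divide_nonneg_nonneg of_nat_0_le_iff)
  have hz: "(h \<longlongrightarrow> z) at_top"
  proof -
    have "((\<lambda>B::real. B / (Q B)\<^sup>2) \<longlongrightarrow> 0) at_top"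
      unfolding Q_def using Xr by real_asymp
    then have "((\<lambda>B. f B - of_int s * K * (B / (Q B)\<^sup>2) / f B) \<longlongrightarrow>
                 z - of_int s * K * 0 / z) at_top"
      by (rule tendsto_diff[OF fz tendsto_divide[OF tendsto_mult[OF tendsto_const] fz z0]])
    then show ?thesis by (simp add: h_def)
  qed
  have Qlim: "filterlim Q at_top at_top" unfolding Q_def using Xr by real_asymp
  have mlim: "filterlim (\<lambda>B. (B - 1) * y) at_top at_top" using y0 by real_asymp
  \<comment> \<open>This will give \<open>b ^ (N - 1) \<le> m\<close>, so that \<open>m\<close> has
    exactly \<open>N\<close> digits.\<close>
  have mlim': "filterlim (\<lambda>B. (B - 1) * y - B / b) at_top at_top"
  proof -
    define d where "d = y - 1 / b"
    have "d > 0" using y by (simp add: d_def)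
    then have "filterlim (\<lambda>B. B * d - y) at_top at_top" by real_asymp
    then show ?thesis by (simp add: d_def algebra_simps)
  qed
  have ev: "\<forall>\<^sub>F B in at_top. 1 / b < f B \<and> f B < 1 \<and> 1 / b < h B \<and> h B < 1 \<and>
      real b * real_of_int q < Q B \<and> real c < (B - 1) * y \<and> 0 \<le> (B - 1) * y - B / b"
    using order_tendstoD[OF fz] order_tendstoD[OF hz] z
      filterlim_at_top_dense[THEN iffD1, OF Qlim] filterlim_at_top_dense[THEN iffD1, OF mlim]
      filterlim_at_top[THEN iffD1, OF mlim', THEN spec, of 0]
    by (intro eventually_conj) auto
  have "filterlim (\<lambda>i. (real b ^ P) ^ i) at_top sequentially"
  proof -
    define c where "c = real b ^ P"
    have "c > 1" unfolding c_def using b P(1) by (simp add: one_less_power)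
    then show ?thesis unfolding c_def[symmetric] by real_asymp
  qed
  then have "\<forall>\<^sub>F i in sequentially. 1 / b < f ((real b ^ P) ^ i) \<and> f ((real b ^ P) ^ i) < 1 \<and>
      1 / b < h ((real b ^ P) ^ i) \<and> h ((real b ^ P) ^ i) < 1 \<and>
      real b * real_of_int q < Q ((real b ^ P) ^ i) \<and> real c < ((real b ^ P) ^ i - 1) * y \<and>
      0 \<le> ((real b ^ P) ^ i - 1) * y - ((real b ^ P) ^ i) / b"
    by (rule eventually_compose_filterlim[OF ev])
  then obtain i0 where i0: "\<And>i. i \<ge> i0 \<Longrightarrow> 1 / b < f ((real b ^ P) ^ i) \<and> f ((real b ^ P) ^ i) < 1 \<and>
      1 / b < h ((real b ^ P) ^ i) \<and> h ((real b ^ P) ^ i) < 1 \<and>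
      real b * real_of_int q < Q ((real b ^ P) ^ i) \<and> real c < ((real b ^ P) ^ i - 1) * y \<and>
      0 \<le> ((real b ^ P) ^ i - 1) * y - ((real b ^ P) ^ i) / b"
    unfolding eventually_sequentially by blast
  \<comment> \<open>The summand \<open>nat X\<close> forces \<open>X < N\<close>, the size condition
    of \<open>periodic_of_power_minus\<close> for \<open>D = X - q'\<close>.\<close>
  define i where "i = i0 + nat X + 1"
  define N where "N = P * i"
  define B where "B = real b ^ N"
  have B: "(real b ^ P) ^ i = B" by (simp add: B_def N_def power_mult)
  have con: "1 / b < f B" "f B < 1" "1 / b < h B" "h B < 1" "real b * real_of_int q < Q B"
      "real c < (B - 1) * y" "B / b \<le> (B - 1) * y"
    using i0[of i] unfolding B by (auto simp: i_def)
  have "i \<le> N" using P(1) by (simp add: N_def)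
  then have N: "int N > X" by (simp add: i_def)
  then have N0: "N > 0" using X by auto
  have B1: "B > 1" unfolding B_def using b N0 by (simp add: one_less_power)
  \<comment> \<open>Since \<open>P\<close> divides \<open>N\<close>, the number
    \<open>(b ^ N - 1) * y\<close> is an integer; it becomes the quotient \<open>m\<close>.\<close>
  have "int b ^ P - 1 dvd int b ^ N - 1"
    unfolding N_def power_mult using power_diff_1_eq[of "int b ^ P" i] by simp
  then have "q dvd (int b ^ N - 1) * X"
    using P(2) by (meson dvd_trans mult_dvd_mono dvd_refl)
  then obtain mi where mi: "(int b ^ N - 1) * X = q * mi" by blast
  have "(int b ^ N - 1) * X \<ge> 0" using X b by simp
  then have "mi \<ge> 0" using mi q by (metis zero_le_mult_iff not_less)
  then obtain m where m: "mi = int m" by (metis nonneg_int_cases)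
  have "of_int ((int b ^ N - 1) * X) = real_of_int (q * mi)" using mi by simp
  then have mr: "(B - 1) * y = real m" using qr by (simp add: m B_def y_def field_simps)
  have "c < m" using con(6) mr by simp
  moreover have "b ^ (N - 1) \<le> m"
  proof -
    have "real b * real b ^ (N - 1) = B" using N0 unfolding B_def by (metis power_eq_if neq0_conv)
    then have "B / b = real b ^ (N - 1)" using b by (auto simp: field_simps)
    then have "real (b ^ (N - 1)) \<le> real m" using con(7) mr by simp
    then show ?thesis by (simp only: of_nat_le_iff)
  qed
  moreover have "m < b ^ N"
  proof -
    have "(B - 1) * y < (B - 1) * 1" using y(2) B1 by (intro mult_strict_left_mono) auto
    then have "real m < B" unfolding mr by simp
    then have "real m < real (b ^ N)" by (simp only: B_def of_nat_power)
    then show ?thesis by (simp only: of_nat_less_iff)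
  qed
  moreover have "good_state b (int m * p + p') p (int m * q + q') q (e * int b ^ N + int m) (L + N)"
  proof -
    define Q2 where "Q2 = int m * q + q'"
    define X2 where "X2 = int b ^ (L + N) * (int m * p + p') - (e * int b ^ N + int m) * Q2"
    have mi': "int m * q = (int b ^ N - 1) * X" using mi m by (simp add: mult.commute)
    have Q2: "Q2 = int b ^ N * X - (X - q')" unfolding Q2_def mi' by (simp add: algebra_simps)
    have Q2r: "of_int Q2 = Q B" unfolding Q2 Q_def B_def by (simp add: algebra_simps)
    have "real b * of_int q > 0" using b qr by simp
    then have QB: "Q B > 0" using con(5) by linarith
    have Q2pos: "Q2 > 0" using QB Q2r by (metis of_int_0_less_iff)
    \<comment> \<open>After multiplication by \<open>q\<close>, the relation
      \<open>m * q = (b ^ N - 1) * X\<close> cancels the large terms and leaves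
      \<open>Q2 * X\<close> and the determinant \<open>s\<close>.\<close>
    have "X2 * q = int b ^ N * Q2 * (int b ^ L * p - e * q) - int m * q * Q2
            + int b ^ L * int b ^ N * s"
      unfolding X2_def Q2_def s_def by (simp add: algebra_simps power_add)
    also have "\<dots> = Q2 * X + int b ^ L * int b ^ N * s"
      unfolding mi' X_def[symmetric] by (simp add: algebra_simps)
    finally have "real_of_int (X2 * q) = of_int (Q2 * X + int b ^ L * int b ^ N * s)" by simp
    then have "of_int X2 * of_int q = Q B * of_int X + of_int s * K * B"
      by (simp add: Q2r K_def B_def)
    then have fB: "of_int X2 / of_int Q2 = f B"
      unfolding f_def y_def Q2r using QB qr by (simp add: field_simps)
    then have X2r: "of_int X2 = Q B * f B" using QB Q2r by (simp add: field_simps)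
    have s2: "p * Q2 - (int m * p + p') * q = - s" by (simp add: Q2_def s_def algebra_simps)
    have hB: "of_int X2 / of_int Q2 + of_int (- s) * real b ^ (L + N) / (of_int Q2 * of_int X2) = h B"
      unfolding fB unfolding h_def X2r Q2r
      by (simp add: K_def B_def power_add power2_eq_square mult.assoc)
    have "q < X2"
    proof -
      have "of_int q < Q B * (1 / b)" using con(5) b by (simp add: field_simps)
      also have "\<dots> < Q B * f B" using con(1) QB by (intro mult_strict_left_mono)
      finally have "real_of_int q < of_int X2" using X2r by simp
      then show ?thesis by simp
    qed
    moreover have "\<exists>P>0. Q2 dvd (int b ^ P - 1) * X2"
    proof -
      obtain P2 where P2: "P2 > 0" "Q2 dvd (int b ^ P2 - 1) * int b ^ (L + N)"
        using periodic_of_power_minus[OF b _ Q2pos Q2, of "L + N"] q' N by auto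
      \<comment> \<open>Modulo \<open>Q2\<close>, \<open>X2\<close> is a multiple of
        \<open>b ^ (L + N)\<close>, so \<open>P2\<close> serves for \<open>X2\<close> as
        well.\<close>
      have "(int b ^ P2 - 1) * X2 = (int b ^ P2 - 1) * int b ^ (L + N) * (int m * p + p')
          - (int b ^ P2 - 1) * (e * int b ^ N + int m) * Q2"
        unfolding X2_def by (simp add: algebra_simps)
      then show ?thesis using P2 by (metis dvd_diff dvd_mult2 dvd_triv_right)
    qed
    ultimately show ?thesis
      unfolding good_state_def Let_def Q2_def[symmetric] X2_def[symmetric] s2 hB
      using con fB s q by auto
  qed
  ultimately show ?thesis using N0 by blast
qed

subsection \<open>Digit strings\<close>

definition digit_value :: "nat \<Rightarrow> nat list \<Rightarrow> nat" where
  "digit_value b ds = foldl (\<lambda>v d. v * b + d) 0 ds"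

definition digit_word :: "nat \<Rightarrow> nat list \<Rightarrow> nat list" where
  "digit_word b xs = concat (map (base_digits b) xs)"

lemma digit_value_Nil [simp]: "digit_value b [] = 0"
  by (simp add: digit_value_def)

lemma digit_value_snoc [simp]: "digit_value b (ds @ [d]) = digit_value b ds * b + d"
  by (simp add: digit_value_def)

lemma digit_value_append:
  "digit_value b (xs @ ys) = digit_value b xs * b ^ length ys + digit_value b ys"
proof (induction ys rule: rev_induct)
  case (snoc y ys)
  then show ?case
    using digit_value_snoc[of b "xs @ ys" y] by (simp add: algebra_simps)
qed simp

lemma digit_word_Nil [simp]: "digit_word b [] = []"
  by (simp add: digit_word_def)

lemma digit_word_append [simp]: "digit_word b (xs @ ys) = digit_word b xs @ digit_word b ys"
  by (simp add: digit_word_def)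

lemma digit_word_single [simp]: "digit_word b [m] = base_digits b m"
  by (simp add: digit_word_def)

lemma base_digits_0 [simp]: "base_digits b 0 = []"
  by (simp add: base_digits.simps)

lemma base_digits_step:
  "b \<ge> 2 \<Longrightarrow> n > 0 \<Longrightarrow> base_digits b n = base_digits b (n div b) @ [n mod b]"
  by (subst base_digits.simps) auto

lemma digit_value_base_digits:
  assumes "b \<ge> 2"
  shows "digit_value b (base_digits b n) = n"
proof (induction n rule: less_induct)
  case (less n)
  show ?case
  proof (cases "n = 0")
    case False
    then have "n div b < n" using assms by (intro div_less_dividend) auto
    then show ?thesis
      using less.IH[of "n div b"] False assms by (simp add: base_digits_step)
  qed simp
qed

lemma set_base_digits:
  assumes "b \<ge> 2"
  shows "set (base_digits b n) \<subseteq> {..<b}"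
proof (induction n rule: less_induct)
  case (less n)
  show ?case
  proof (cases "n = 0")
    case False
    then have "n div b < n" using assms by (intro div_less_dividend) auto
    then show ?thesis
      using less.IH[of "n div b"] False assms by (simp add: base_digits_step)
  qed simp
qed

lemma length_base_digits:
  assumes "b \<ge> 2"
  shows "b ^ n \<le> m \<Longrightarrow> m < b ^ Suc n \<Longrightarrow> length (base_digits b m) = Suc n"
proof (induction n arbitrary: m)
  case 0
  then show ?case using assms by (simp add: base_digits_step)
next
  case (Suc n)
  have "m > 0" using Suc.prems(1) assms by (metis gr0I le_zero_eq not_numeral_le_zero power_not_zero)
  moreover have "b ^ n \<le> m div b"
    using Suc.prems(1) assms by (simp add: less_eq_div_iff_mult_less_eq mult.commute)
  moreover have "m div b < b ^ Suc n"
    using Suc.prems(2) assms by (simp add: div_less_iff_less_mult mult.commute)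
  ultimately show ?case using Suc.IH[of "m div b"] assms by (simp add: base_digits_step)
qed

lemma base_digits_bounds:
  assumes "b \<ge> 2" "m > 0"
  obtains n where "length (base_digits b m) = Suc n" "b ^ n \<le> m" "m < b ^ Suc n"
proof -
  obtain n where "b ^ n \<le> m" "m < b ^ (n + 1)"
    using ex_power_ivl1[of b m] assms by auto
  then show ?thesis using that length_base_digits[of b n m] assms by simp
qed

lemma length_digit_word_ge:
  assumes "b \<ge> 2" "\<forall>x\<in>set xs. x > 0"
  shows "length xs \<le> length (digit_word b xs)"
  using assms(2)
proof (induction xs rule: rev_induct)
  case (snoc x xs)
  then obtain n where "length (base_digits b x) = Suc n"
    using base_digits_bounds[OF assms(1), of x] by auto
  then show ?case using snoc by simp
qed simp

lemma digit_word_less: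
  assumes "b \<ge> 2" "d \<in> set (digit_word b xs)"
  shows "d < b"
  using assms set_base_digits[OF assms(1)] by (auto simp: digit_word_def)

section \<open>Base expansions of the concatenated digits\<close>

lemma concat_digit_eq_nth:
  assumes b: "b \<ge> 2" and a: "\<forall>i. a i > 0" and k: "k < length (digit_word b (map a [0..<n]))"
  shows "concat_digit b a k = digit_word b (map a [0..<n]) ! k"
proof -
  define W where "W = (\<lambda>n. digit_word b (map a [0..<n]))"
  have *: "W j ! k = W i ! k" if "i \<le> j" "k < length (W i)" for i j
  proof -
    have "[0..<j] = [0..<i] @ [i..<j]" using that(1) by (metis le0 le_add_diff_inverse upt_add_eq_append)
    then have "W j = W i @ digit_word b (map a [i..<j])" by (simp add: W_def)
    then show ?thesis using that(2) by (simp add: nth_append)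
  qed
  \<comment> \<open>Every digit string is nonempty, so \<open>Suc k\<close> of them reach position
    \<open>k\<close>.\<close>
  have "Suc k \<le> length (W (Suc k))"
    using length_digit_word_ge[OF b, of "map a [0..<Suc k]"] a unfolding W_def by simp
  then have "W (Suc k) ! k = W n ! k"
    using *[of "Suc k" n] *[of n "Suc k"] k by (cases "Suc k \<le> n") (auto simp: W_def)
  then show ?thesis by (simp add: concat_digit_def W_def digit_word_def comp_def del: upt_Suc)
qed

lemma concat_digit_less:
  assumes b: "b \<ge> 2" and a: "\<forall>i. a i > 0"
  shows "concat_digit b a k < b"
proof -
  have "k < length (digit_word b (map a [0..<Suc k]))"
    using length_digit_word_ge[OF b, of "map a [0..<Suc k]"] a by simp
  then show ?thesis
    unfolding concat_digit_eq_nth[OF b a \<open>k < _\<close>] by (rule digit_word_less[OF b nth_mem])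
qed

lemma digit_partial_sum:
  assumes "b > 0"
  shows "(\<Sum>k<length ds. real (ds ! k) / real b ^ Suc k) = digit_value b ds / real b ^ length ds"
proof (induction ds rule: rev_induct)
  case (snoc d ds)
  have "(\<Sum>k<length ds. real ((ds @ [d]) ! k) / real b ^ Suc k)
      = (\<Sum>k<length ds. real (ds ! k) / real b ^ Suc k)"
    by (intro sum.cong) (auto simp: nth_append)
  then show ?case using snoc assms by (simp add: field_simps)
qed simp

lemma concat_digit_partial_sum:
  assumes b: "b \<ge> 2" and a: "\<forall>i. a i > 0"
  defines "W \<equiv> \<lambda>n. digit_word b (map a [0..<n])"
  shows "(\<Sum>k<length (W n). real (concat_digit b a k) / real b ^ Suc k)
           = digit_value b (W n) / real b ^ length (W n)"
proof -
  have "(\<Sum>k<length (W n). real (concat_digit b a k) / real b ^ Suc k)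
      = (\<Sum>k<length (W n). real (W n ! k) / real b ^ Suc k)"
    unfolding W_def by (intro sum.cong) (auto simp: concat_digit_eq_nth[OF b a])
  then show ?thesis using digit_partial_sum[of b "W n"] b by simp
qed

lemma geometric_digit_sums:
  assumes "b \<ge> 2"
  shows "(\<lambda>k. (real b - 1) / real b ^ Suc k) sums 1"
proof -
  have "(\<lambda>k. (real b - 1) / b * (1 / real b) ^ k) sums ((real b - 1) / b * (1 / (1 - 1 / real b)))"
    using assms by (intro sums_mult geometric_sums) auto
  moreover have "(real b - 1) / b * (1 / (1 - 1 / real b)) = 1"
    using assms by (simp add: field_simps)
  ultimately show ?thesis by (simp add: power_one_over field_simps)
qed

text \<open>Scaled by \<open>b ^ L\<close>, the tail of the series lies between 0 and the value 1 of
  the expansion with all digits \<open>b - 1\<close>.\<close>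

lemma base_expansion_approx:
  assumes b: "b \<ge> 2" and a: "\<forall>i. a i > 0" and x: "is_base_expansion b (concat_digit b a) x"
  defines "W \<equiv> \<lambda>n. digit_word b (map a [0..<n])"
  shows "digit_value b (W n) \<le> real b ^ length (W n) * x"
    and "real b ^ length (W n) * x \<le> digit_value b (W n) + 1"
proof -
  define d where "d = concat_digit b a"
  define L where "L = length (W n)"
  have bL: "real b ^ L > 0" using b by simp
  have sx: "(\<lambda>k. real (d k) / real b ^ Suc k) sums x"
    using x by (simp add: is_base_expansion_def d_def)
  define t where "t = x - (\<Sum>k<L. real (d k) / real b ^ Suc k)"
  have "(\<lambda>k. real (d (k + L)) / real b ^ Suc (k + L)) sums t"
    unfolding t_def using sx by (subst sums_iff_shift) simp
  then have "(\<lambda>k. real b ^ L * (real (d (k + L)) / real b ^ Suc (k + L))) sums (real b ^ L * t)"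
    by (rule sums_mult)
  moreover have "real b ^ L * (real (d (k + L)) / real b ^ Suc (k + L)) = real (d (k + L)) / real b ^ Suc k" for k
    using bL by (simp add: power_add)
  ultimately have st: "(\<lambda>k. real (d (k + L)) / real b ^ Suc k) sums (real b ^ L * t)"
    by simp
  have "real (d k) \<le> real b - 1" for k
    using concat_digit_less[OF b a, of k] b unfolding d_def by linarith
  then have "real b ^ L * t \<le> 1"
    by (intro sums_le[OF _ st geometric_digit_sums[OF b]] divide_right_mono) auto
  moreover have "0 \<le> real b ^ L * t"
    by (intro sums_le[OF _ sums_zero st]) auto
  moreover have "real b ^ L * t = real b ^ L * x - digit_value b (W n)"
    using concat_digit_partial_sum[OF b a, of n] bL
    unfolding t_def d_def L_def W_def by (simp add: field_simps)
  ultimately show "digit_value b (W n) \<le> real b ^ length (W n) * x"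
    and "real b ^ length (W n) * x \<le> digit_value b (W n) + 1"
    by (simp_all add: L_def)
qed

lemma base_expansion_exists:
  fixes a :: "nat \<Rightarrow> nat"
  assumes b: "b \<ge> 2" and a: "\<forall>i. a i > 0"
  obtains x where "is_base_expansion b (concat_digit b a) x"
proof -
  have "summable (\<lambda>k. real (concat_digit b a k) / real b ^ Suc k)"
  proof (rule summable_comparison_test)
    have "real (concat_digit b a k) \<le> real b - 1" for k
      using concat_digit_less[OF b a, of k] b by linarith
    then show "\<exists>N. \<forall>k\<ge>N. norm (real (concat_digit b a k) / real b ^ Suc k)
                 \<le> (real b - 1) / real b ^ Suc k"
      by (auto intro!: divide_right_mono)
    show "summable (\<lambda>k. (real b - 1) / real b ^ Suc k)"
      using geometric_digit_sums[OF b] by (rule sums_summable)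
  qed
  then show ?thesis
    using that concat_digit_less[OF b a] by (auto simp: is_base_expansion_def dest: summable_sums)
qed

subsection \<open>Continued fractions\<close>

text \<open>The tuple holds the numerators and denominators of two consecutive convergents, the
  later one first in each pair; \<open>(0, 1, 1, 0)\<close> belongs to the empty continued
  fraction.\<close>

fun cf_step :: "int \<times> int \<times> int \<times> int \<Rightarrow> nat \<Rightarrow> int \<times> int \<times> int \<times> int" where
  "cf_step (p, p', q, q') m = (int m * p + p', p, int m * q + q', q)"

lemma cf_convergent_nonneg: "cf_convergent a n \<ge> 0"
  by (induction n arbitrary: a) auto

text \<open>
  An arbitrary initial matrix makes the induction work: \<open>cf_convergent\<close> recurses on the first
  quotient, \<open>foldl cf_step\<close> on the last.
\<close>

lemma foldl_cf_step:
  assumes "\<forall>i. a i > 0" "q > 0" "q' \<ge> 0"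
    "foldl cf_step (p, p', q, q') (map a [0..<n]) = (P, P', Q, Q')"
  shows "(of_int p + of_int p' * cf_convergent a n) / (of_int q + of_int q' * cf_convergent a n)
           = real_of_int P / of_int Q"
  using assms
proof (induction n arbitrary: a p p' q q')
  case (Suc n)
  let ?a = "\<lambda>i. a (Suc i)" 
  define z where "z = cf_convergent ?a n"
  have z: "z \<ge> 0" unfolding z_def by (rule cf_convergent_nonneg)
  have a0: "real (a 0) > 0" using Suc.prems(1) by simp
  have q: "int (a 0) * q + q' > 0" using Suc.prems(1)[rule_format, of 0] Suc.prems(2,3)
    by (simp add: add_pos_nonneg)
  have "map a [0..<Suc n] = a 0 # map ?a [0..<n]" by (rule map_upt_Suc)
  then have "(of_int (int (a 0) * p + p') + of_int p * z) / (of_int (int (a 0) * q + q') + of_int q * z)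
           = real_of_int P / of_int Q"
    using Suc.IH[of ?a "int (a 0) * q + q'" q "int (a 0) * p + p'" p] Suc.prems q
    by (simp add: z_def)
  moreover have "cf_convergent a (Suc n) = 1 / (a 0 + z)" by (simp add: z_def)
  moreover have "a 0 + z > 0" using a0 z by linarith
  then have "(of_int p + of_int p' * (1 / (a 0 + z))) / (of_int q + of_int q' * (1 / (a 0 + z)))
      = (of_int (int (a 0) * p + p') + of_int p * z) / (of_int (int (a 0) * q + q') + of_int q * z)"
  proof -
    assume h: "a 0 + z > 0"
    have "of_int p + of_int p' * (1 / (a 0 + z)) = (of_int (int (a 0) * p + p') + of_int p * z) / (a 0 + z)"
      "of_int q + of_int q' * (1 / (a 0 + z)) = (of_int (int (a 0) * q + q') + of_int q * z) / (a 0 + z)"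
      using h by (simp_all add: field_simps)
    then show ?thesis using h by simp
  qed
  ultimately show ?case by simp
qed simp

section \<open>Tails and uniqueness of continued fraction expansions\<close>

lemma is_cf_expansion_unfold:
  assumes "is_cf_expansion a x"
  obtains z :: real where "is_cf_expansion (\<lambda>i. a (Suc i)) z" "x = 1 / (a 0 + z)" "0 \<le> z"
proof -
  have a: "\<forall>i. a i > 0" and lim: "cf_convergent a \<longlonglongrightarrow> x"
    using assms by (auto simp: is_cf_expansion_def)
  let ?a = "\<lambda>i. a (Suc i)"
  have le1: "cf_convergent a' n \<le> 1" if "\<forall>i. a' i > 0" for a' n
  proof (cases n)
    case (Suc k)
    have "real (a' 0) + cf_convergent (\<lambda>i. a' (Suc i)) k \<ge> 1"
      using that[rule_format, of 0] cf_convergent_nonneg[of "\<lambda>i. a' (Suc i)" k] by linarith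
    then show ?thesis by (simp add: Suc)
  qed simp
  have den: "real (a 0) + cf_convergent ?a n > 0" for n
    using a[rule_format, of 0] cf_convergent_nonneg[of ?a n] by (simp add: add_pos_nonneg)
  have lim': "(\<lambda>n. cf_convergent a (Suc n)) \<longlonglongrightarrow> x" using lim by (rule LIMSEQ_Suc)
  \<comment> \<open>A uniform positive lower bound keeps \<open>x\<close> away from 0, so the
    reciprocals of the convergents converge as well.\<close>
  have "1 / (real (a 0) + 1) \<le> cf_convergent a (Suc n)" for n
    using le1[of ?a n] a den[of n] by (auto intro!: divide_left_mono mult_pos_pos)
  then have "1 / (real (a 0) + 1) \<le> x" by (intro LIMSEQ_le_const[OF lim']) auto
  moreover have "0 < 1 / (real (a 0) + 1)" by simp
  ultimately have x: "x > 0" by linarith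
  have "(\<lambda>n. 1 / cf_convergent a (Suc n) - a 0) \<longlonglongrightarrow> 1 / x - a 0"
    using x by (intro tendsto_intros lim') auto
  then have lz: "cf_convergent ?a \<longlonglongrightarrow> 1 / x - a 0" by simp
  have "0 \<le> 1 / x - a 0"
    by (rule LIMSEQ_le_const[OF lz]) (auto simp: cf_convergent_nonneg)
  then show ?thesis using that[of "1 / x - a 0"] lz a by (simp add: is_cf_expansion_def)
qed

lemma is_cf_expansion_pos:
  assumes "is_cf_expansion a x"
  shows "0 < x"
proof -
  obtain z :: real where "is_cf_expansion (\<lambda>i. a (Suc i)) z" "x = 1 / (a 0 + z)" "0 \<le> z"
    by (rule is_cf_expansion_unfold[OF assms])
  moreover have "real (a 0) > 0" using assms by (simp add: is_cf_expansion_def)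
  ultimately show ?thesis by (simp add: add_pos_nonneg)
qed

lemma is_cf_expansion_less_1:
  assumes "is_cf_expansion a x"
  shows "x < 1"
proof -
  obtain z :: real where z: "is_cf_expansion (\<lambda>i. a (Suc i)) z" "x = 1 / (a 0 + z)" "0 \<le> z"
    by (rule is_cf_expansion_unfold[OF assms])
  have "real (a 0) \<ge> 1" using assms by (simp add: is_cf_expansion_def Suc_leI)
  then show ?thesis using is_cf_expansion_pos[OF z(1)] z(2) by simp
qed

lemma is_cf_expansion_Suc:
  assumes "is_cf_expansion a x"
  obtains z :: real where "is_cf_expansion (\<lambda>i. a (Suc i)) z" "x = 1 / (a 0 + z)" "0 < z" "z < 1"
proof -
  obtain z :: real where z: "is_cf_expansion (\<lambda>i. a (Suc i)) z" "x = 1 / (a 0 + z)" "0 \<le> z"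
    by (rule is_cf_expansion_unfold[OF assms])
  show ?thesis
    by (rule that[OF z(1,2) is_cf_expansion_pos[OF z(1)] is_cf_expansion_less_1[OF z(1)]])
qed

text \<open>Tails strictly between 0 and 1 make the quotient the integer part of the
  reciprocal.\<close>

lemma cf_head_eq:
  fixes z z' :: real and m n :: nat
  assumes "1 / (m + z) = 1 / (n + z')" "0 < z" "z < 1" "0 < z'" "z' < 1"
  shows "m = n \<and> z = z'"
proof -
  have e: "m + z = n + z'" using assms(1) by simp
  have "real m < real (n + 1)" "real n < real (m + 1)" using e assms(2-5) by auto
  then have "m = n" by linarith
  then show ?thesis using e by simp
qed

lemma is_cf_expansion_unique:
  assumes "is_cf_expansion a x" "is_cf_expansion a' x"
  shows "a n = a' n"
  using assms
proof (induction n arbitrary: a a' x)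
  case (0 a a' x)
  obtain z :: real where z: "is_cf_expansion (\<lambda>i. a (Suc i)) z" "x = 1 / (a 0 + z)" "0 < z" "z < 1"
    by (rule is_cf_expansion_Suc[OF 0(1)])
  obtain z' :: real where z': "is_cf_expansion (\<lambda>i. a' (Suc i)) z'" "x = 1 / (a' 0 + z')" "0 < z'" "z' < 1"
    by (rule is_cf_expansion_Suc[OF 0(2)])
  show ?case using cf_head_eq[of "a 0" z "a' 0" z'] z z' by auto
next
  case (Suc n a a' x)
  obtain z :: real where z: "is_cf_expansion (\<lambda>i. a (Suc i)) z" "x = 1 / (a 0 + z)" "0 < z" "z < 1"
    by (rule is_cf_expansion_Suc[OF Suc.prems(1)])
  obtain z' :: real where z': "is_cf_expansion (\<lambda>i. a' (Suc i)) z'" "x = 1 / (a' 0 + z')" "0 < z'" "z' < 1"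
    by (rule is_cf_expansion_Suc[OF Suc.prems(2)])
  have "z = z'" using cf_head_eq[of "a 0" z "a' 0" z'] z z' by auto
  then show ?case using Suc.IH[OF z(1)] z'(1) by simp
qed

subsection \<open>Uncountably many continuations\<close>

definition good_prefix :: "nat \<Rightarrow> nat list \<Rightarrow> bool" where
  "good_prefix b xs \<longleftrightarrow>
     (case foldl cf_step (0, 1, 1, 0) xs of (p, p', q, q') \<Rightarrow>
        good_state b p p' q q' (digit_value b (digit_word b xs)) (length (digit_word b xs)))"

lemma good_prefix_extend:
  assumes b: "b \<ge> 2" and good: "good_prefix b xs"
  shows "\<exists>m>c. good_prefix b (xs @ [m])"
proof -
  obtain p p' q q' where st: "foldl cf_step (0, 1, 1, 0) xs = (p, p', q, q')"
    by (metis prod.exhaust)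
  define e where "e = digit_value b (digit_word b xs)"
  define L where "L = length (digit_word b xs)"
  have gs: "good_state b p p' q q' e L" using good st by (simp add: good_prefix_def e_def L_def)
  obtain m N where mN: "c < m \<and> 0 < N \<and> b ^ (N - 1) \<le> m \<and> m < b ^ N \<and>
      good_state b (int m * p + p') p (int m * q + q') q (int e * int b ^ N + int m) (L + N)"
    using good_state_extend[OF b gs, of c] by (elim exE)
  then have m: "c < m" "0 < N" "b ^ (N - 1) \<le> m" "m < b ^ N"
    and g: "good_state b (int m * p + p') p (int m * q + q') q (int e * int b ^ N + int m) (L + N)"
    by simp_all
  have "length (base_digits b m) = N"
    using length_base_digits[OF b, of "N - 1" m] m by simp
  then have "good_prefix b (xs @ [m])"
    using g st digit_value_base_digits[OF b]
    by (simp add: good_prefix_def digit_value_append e_def L_def)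
  then show ?thesis using m(1) by blast
qed

text \<open>Since \<open>p / q = (e + y) / b ^ L\<close> with \<open>0 < y < 1\<close>, the
  convergent lies in the \<open>b\<close>-adic interval cut out by its own digit word.\<close>

lemma good_prefix_convergent:
  assumes b: "b \<ge> 2" and a: "\<forall>i. a i > 0" and good: "good_prefix b (map a [0..<n])"
  defines "w \<equiv> digit_word b (map a [0..<n])"
  shows "\<bar>cf_convergent a n - digit_value b w / real b ^ length w\<bar> \<le> 1 / real b ^ length w"
proof -
  obtain p p' q q' where st: "foldl cf_step (0, 1, 1, 0) (map a [0..<n]) = (p, p', q, q')"
    by (metis prod.exhaust)
  define e where "e = int (digit_value b w)"
  define L where "L = length w"
  define X where "X = int b ^ L * p - e * q"
  have gs: "good_state b p p' q q' e L"
    using good st by (simp add: good_prefix_def e_def L_def w_def)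
  have bL: "real b ^ L > 0" using b by simp
  have X: "X > 0" and y: "1 / b < of_int X / real_of_int q" "of_int X / real_of_int q < 1"
    using gs unfolding good_state_def Let_def X_def[symmetric] by auto
  have y0: "of_int X / real_of_int q > 0"
    using y(1) by (rule le_less_trans[rotated]) simp
  then have q: "real_of_int q > 0" using X by (simp add: zero_less_divide_iff)
  have "cf_convergent a n = of_int p / of_int q"
    using foldl_cf_step[OF a _ _ st] by simp
  then have "cf_convergent a n - of_int e / real b ^ L = (of_int X / of_int q) / real b ^ L"
    using q bL unfolding X_def by (simp add: field_simps)
  moreover have "(of_int X / of_int q) / real b ^ L \<le> 1 / real b ^ L"
    using y bL by (intro divide_right_mono) auto
  moreover have "0 \<le> (of_int X / real_of_int q) / real b ^ L" 
    by (rule divide_nonneg_pos[OF less_imp_le[OF y0] bL])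
  ultimately show ?thesis unfolding e_def L_def by (simp only: abs_of_nonneg of_int_of_nat_eq)
qed

text \<open>Diagonal argument: against a supposed enumeration, the quotient at position
  \<open>length xs + n\<close> is chosen larger than the corresponding quotient of the
  \<open>n\<close>-th number.\<close>

lemma uncountable_trott_numbers_if_good_prefix:
  assumes b: "b \<ge> 2" and good: "good_prefix b xs" and pos: "\<forall>x\<in>set xs. x > 0"
  shows "uncountable (trott_numbers b)"
proof
  assume count: "countable (trott_numbers b)"
  define enum where "enum = from_nat_into (trott_numbers b)"
  \<comment> \<open>\<open>SOME\<close> picks an expansion of \<open>enum n\<close>; its value
    matters only for the \<open>n\<close> with \<open>enum n = x\<close> found at the end.\<close>
  define c where "c = (\<lambda>n. (SOME a. is_cf_expansion a (enum n)) (length xs + n))"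
  define ext where "ext = (\<lambda>n ys. SOME m. m > c n \<and> good_prefix b (ys @ [m]))"
  define s where "s = rec_nat xs (\<lambda>n ys. ys @ [ext n ys])"
  have s_0 [simp]: "s 0 = xs" and s_Suc: "\<And>n. s (Suc n) = s n @ [ext n (s n)]"
    by (simp_all add: s_def)
  have len: "length (s n) = length xs + n" for n by (induction n) (simp_all add: s_Suc)
  have ext_spec: "ext n (s n) > c n \<and> good_prefix b (s n @ [ext n (s n)])"
    if "good_prefix b (s n)" for n
    using someI_ex[OF good_prefix_extend[OF b that, of "c n"]] unfolding ext_def .
  have good_s: "good_prefix b (s n)" for n
    by (induction n) (use good ext_spec in \<open>simp_all add: s_Suc\<close>)
  have ext_gt: "ext n (s n) > c n" for n using ext_spec good_s by blast
  have pos_s: "\<forall>x\<in>set (s n). x > 0" for n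
  proof (induction n)
    case (Suc n)
    then show ?case using ext_gt[of n] by (simp add: s_Suc)
  qed (use pos in simp)
  define a where "a = (\<lambda>i. s (Suc i) ! i)"
  have s_mono: "s (n + k) ! i = s n ! i" if "i < length (s n)" for n k i
    using that by (induction k) (simp_all add: s_Suc nth_append len)
  have nth_s: "s n ! i = a i" if "i < length (s n)" for n i
    unfolding a_def using that s_mono[of i n "Suc i"] s_mono[of i "Suc i" n] len
    by (simp add: add.commute)
  have map_a: "map a [0..<length xs + n] = s n" for n
    by (rule nth_equalityI) (use nth_s len in auto)
  have a: "\<forall>i. a i > 0"
  proof
    fix i
    have "a i \<in> set (s (Suc i))" unfolding a_def by (rule nth_mem) (simp add: len)
    then show "a i > 0" using pos_s by blast
  qed
  obtain x where x: "is_base_expansion b (concat_digit b a) x"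
    using base_expansion_exists[OF b a] by blast
  define w where "w = (\<lambda>n. digit_word b (map a [0..<n]))"
  have lw: "n \<le> length (w n)" for n
    using length_digit_word_ge[OF b, of "map a [0..<n]"] a by (simp add: w_def)
  have lim: "cf_convergent a \<longlonglongrightarrow> x"
  \<comment> \<open>Goodness is available only for prefixes of length at least
    \<open>length xs\<close>, hence the offset. There the convergent and \<open>x\<close> are both
    within \<open>1 / b ^ L\<close> of the value of the digit word, and \<open>L\<close> is at least
    the number of quotients.\<close>
  proof (rule LIMSEQ_offset[where k = "length xs"], rule LIM_zero_cancel, rule tendsto_rabs_zero_cancel)
    show "(\<lambda>n. \<bar>cf_convergent a (n + length xs) - x\<bar>) \<longlonglongrightarrow> 0"
    proof (rule tendsto_sandwich[OF _ _ tendsto_const])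
      show "\<forall>\<^sub>F n in sequentially. 0 \<le> \<bar>cf_convergent a (n + length xs) - x\<bar>" by simp
      show "\<forall>\<^sub>F n in sequentially. \<bar>cf_convergent a (n + length xs) - x\<bar> \<le> 2 * (1 / real b) ^ n"
      proof (intro always_eventually allI)
        fix n
        define m where "m = n + length xs"
        define L where "L = length (w m)"
        have bL: "real b ^ L > 0" using b by simp
        have "good_prefix b (map a [0..<m])" using good_s map_a by (simp add: m_def add.commute)
        from good_prefix_convergent[OF b a this]
        have "\<bar>cf_convergent a m - digit_value b (w m) / real b ^ L\<bar> \<le> 1 / real b ^ L"
          by (simp add: w_def L_def)
        moreover have "\<bar>digit_value b (w m) / real b ^ L - x\<bar> \<le> 1 / real b ^ L"
        proof -
          have "digit_value b (w m) / real b ^ L \<le> x"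
            using base_expansion_approx(1)[OF b a x, of m] bL
            by (simp add: w_def L_def divide_le_eq mult.commute)
          moreover have "x \<le> (real (digit_value b (w m)) + 1) / real b ^ L"
            using base_expansion_approx(2)[OF b a x, of m] bL
            by (simp add: w_def L_def le_divide_eq mult.commute)
          ultimately show ?thesis by (simp add: add_divide_distrib)
        qed
        ultimately have "\<bar>cf_convergent a m - x\<bar> \<le> 2 * (1 / real b ^ L)" by linarith
        also have "\<dots> \<le> 2 * (1 / real b ^ n)"
          using lw[of m] b unfolding L_def[symmetric]
          by (intro mult_left_mono divide_left_mono power_increasing) (auto simp: m_def)
        finally show "\<bar>cf_convergent a (n + length xs) - x\<bar> \<le> 2 * (1 / real b) ^ n"
          by (simp add: m_def power_one_over)
      qed
      have "(\<lambda>n. 2 * (1 / real b) ^ n) \<longlonglongrightarrow> 2 * 0"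
        using b by (intro tendsto_mult tendsto_const LIMSEQ_power_zero) auto
      then show "(\<lambda>n. 2 * (1 / real b) ^ n) \<longlonglongrightarrow> 0" by simp
    qed
  qed
  have cf: "is_cf_expansion a x" using a lim by (simp add: is_cf_expansion_def)
  then have "x \<in> trott_numbers b"
    using x is_cf_expansion_pos[OF cf] is_cf_expansion_less_1[OF cf]
    by (auto simp: trott_numbers_def)
  then obtain n where "enum n = x" unfolding enum_def using from_nat_into_surj[OF count] by blast
  \<comment> \<open>As \<open>x\<close> has the expansion \<open>a\<close>, the chosen sequence is
    an expansion of \<open>x\<close> too, and uniqueness identifies it with
    \<open>a\<close>.\<close>
  then have "is_cf_expansion (SOME a. is_cf_expansion a (enum n)) x"
    using cf by (metis someI)
  then have "c n = a (length xs + n)"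
    unfolding c_def by (rule is_cf_expansion_unique[OF _ cf])
  also have "\<dots> = s (Suc n) ! (length xs + n)" by (rule nth_s[symmetric]) (simp add: len)
  also have "\<dots> = ext n (s n)" by (simp add: s_Suc nth_append len)
  finally show False using ext_gt[of n] by simp
qed

subsection \<open>Necessity\<close>

text \<open>Here \<open>k\<close> and \<open>m\<close> are the first two quotients, \<open>z\<close>
  is the tail after \<open>k\<close>, and \<open>y = b * x - k\<close> is what follows the first
  digit.\<close>

lemma trott_first_quotients:
  assumes b: "b \<ge> 2" and x: "x \<in> trott_numbers b"
  obtains k m :: nat and y z :: real where
    "k > 0" "m > 0" "(k + y) * (k + z) = b" "0 \<le> y" "y \<le> 1" "0 < z" "z < 1" "m * z < 1"
    "m < b \<longrightarrow> real b * y \<le> real m + 1"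
proof -
  obtain a where cf: "is_cf_expansion a x" and be: "is_base_expansion b (concat_digit b a) x"
    and x01: "0 < x" "x < 1"
    using x by (auto simp: trott_numbers_def)
  have a: "\<forall>i. a i > 0" using cf by (simp add: is_cf_expansion_def)
  obtain z :: real where z: "is_cf_expansion (\<lambda>i. a (Suc i)) z" "x = 1 / (a 0 + z)" "0 < z" "z < 1"
    by (rule is_cf_expansion_Suc[OF cf])
  obtain v :: real where v: "z = 1 / (a 1 + v)" "0 < v" "v < 1"
    by (rule is_cf_expansion_Suc[OF z(1)]) simp
  define k where "k = a 0"
  define m where "m = a 1"
  have km: "k > 0" "m > 0" using a by (simp_all add: k_def m_def)
  have xkz: "x * (k + z) = 1" using z km by (simp add: k_def)
  have "m * z + v * z = 1" using v km by (simp add: m_def field_simps)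
  moreover have "v * z > 0" using v z by simp
  ultimately have mz: "m * z < 1" by linarith
  obtain n where n: "length (base_digits b k) = Suc n" "b ^ n \<le> k"
    using base_digits_bounds[OF b km(1)] by blast
  have dk: "digit_value b (base_digits b k) = k" by (rule digit_value_base_digits[OF b])
  have lo: "real k \<le> real b ^ Suc n * x" and hi: "real b ^ Suc n * x \<le> real k + 1"
    using base_expansion_approx[OF b a be, of 1] n dk by (simp_all add: k_def)
  \<comment> \<open>\<open>k\<close> is a single digit: otherwise
    \<open>b \<le> b ^ n \<le> k\<close>, and the first \<open>n + 1\<close> digits give
    \<open>k * (k + z) \<le> b * b ^ n \<le> k * k\<close>, against \<open>z > 0\<close>.\<close>
  have n0: "n = 0"
  proof (rule ccontr)
    assume "n \<noteq> 0"
    then obtain n' where n': "n = Suc n'" by (cases n) auto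
    have bn: "real b ^ n \<le> k" using n(2) by (metis of_nat_le_iff of_nat_power)
    have "real b \<le> real b ^ n" using b n' by (simp add: self_le_power)
    have "real k * (k + z) \<le> real b ^ Suc n * x * (k + z)" using lo z km by (intro mult_right_mono) auto
    also have "\<dots> = real b * real b ^ n" using xkz by (simp add: mult.assoc)
    also have "\<dots> \<le> real k * real k"
      using bn \<open>real b \<le> real b ^ n\<close> by (intro mult_mono) auto
    finally have "real k * z \<le> 0" by (simp add: algebra_simps)
    moreover have "real k * z > 0" using km z by simp
    ultimately show False by linarith
  qed
  define y where "y = b * x - k"
  have y: "0 \<le> y" "y \<le> 1" using lo hi by (simp_all add: n0 y_def)
  have yz: "(k + y) * (k + z) = b" using xkz by (simp add: y_def mult.assoc)
  \<comment> \<open>If \<open>m < b\<close>, then \<open>m\<close> is the second digit of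
    \<open>x\<close>.\<close>
  have by1: "real b * y \<le> real m + 1" if "m < b"
  proof -
    have lm: "length (base_digits b m) = 1" using length_base_digits[OF b, of 0 m] km that by simp
    have "digit_word b (map a [0..<2]) = base_digits b k @ base_digits b m"
      by (simp add: digit_word_def k_def m_def numeral_2_eq_2)
    then have "real b ^ 2 * x \<le> real (k * b + m) + 1"
      using base_expansion_approx(2)[OF b a be, of 2] lm n n0 dk
        digit_value_base_digits[OF b, of m] by (simp add: digit_value_append numeral_2_eq_2)
    then show ?thesis by (simp add: y_def algebra_simps power2_eq_square)
  qed
  show ?thesis by (rule that[OF km yz y z(3,4) mz]) (use by1 in blast)
qed

text \<open>Above \<open>k ^ 2 + k\<close>, the equation \<open>(k + y) * (k + z) = b\<close> needs
  \<open>k * (y + z) + y * z \<ge> k + 1\<close>. But a large \<open>m\<close> makes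
  \<open>z\<close> small and a small \<open>m\<close> makes \<open>y\<close> small, which leaves
  only \<open>b = 3\<close>.\<close>

lemma Gamma_set_if_trott_nonempty:
  assumes b: "b \<ge> 2" and x: "x \<in> trott_numbers b"
  shows "b \<in> Gamma_set"
proof -
  obtain k m :: nat and y z :: real where k: "k > 0" and m: "m > 0"
    and e: "(k + y) * (k + z) = b" and y: "0 \<le> y" "y \<le> 1" and z: "0 < z" "z < 1"
    and mz: "m * z < 1" and my: "m < b \<longrightarrow> real b * y \<le> real m + 1"
    by (rule trott_first_quotients[OF b x]) 
  have "real k * k < (k + y) * (k + z)"
    using k y z by (intro mult_le_less_imp_less) auto
  then have lower: "k\<^sup>2 < b" unfolding e power2_eq_square by (metis of_nat_less_iff of_nat_mult)
  have ub: "real b \<le> (k + 1) * (k + z)"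
    unfolding e[symmetric] using y z by (intro mult_right_mono) auto
  show ?thesis
  proof (cases "b \<le> k\<^sup>2 + k")
    case True
    then have "b \<in> {k\<^sup>2 + 1..k\<^sup>2 + k}" using lower by simp
    then show ?thesis using k unfolding Gamma_set_def by (intro UnI2 UN_I[of k]) auto
  next
    case False
    then have bk: "b \<ge> k\<^sup>2 + k + 1" by simp
    then have "real b \<ge> real (k\<^sup>2 + k + 1)" by (simp only: of_nat_le_iff)
    then have bkr: "real b \<ge> real k * k + k + 1" by (simp add: power2_eq_square)
    have bgt: "b \<ge> k + 1" using bk by simp
    \<comment> \<open>Otherwise \<open>z < 1 / b\<close>, and the bound
      \<open>(k + 1) * (k + z)\<close> drops below \<open>k ^ 2 + k + 1\<close>.\<close>
    have mb: "m < b"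
    proof (rule ccontr)
      assume "\<not> m < b"
      then have "b * z \<le> m * z" using z by (intro mult_right_mono) auto
      then have bz: "b * z < 1" using mz by linarith
      have "(k + 1) * z \<le> b * z" using bgt z by (intro mult_right_mono) auto
      then show False using ub bkr bz by (simp add: algebra_simps)
    qed
    have k1: "k = 1"
    proof (rule ccontr)
      assume "k \<noteq> 1"
      then have k2: "k \<ge> 2" using k by simp
      have "k * 2 \<le> k\<^sup>2" unfolding power2_eq_square using k2 by (intro mult_left_mono) auto
      \<comment> \<open>The assumption \<open>k \<ge> 2\<close> enters here; the bound fails for
        \<open>k = 1\<close>, \<open>b = 3\<close>.\<close>
      then have b2: "b \<ge> 2 * k + 2" using bk k2 by linarith
      have "(k + 1) * (m + 1) \<le> (k + 1) * (2 * m)" using m by (intro mult_left_mono) auto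
      also have "\<dots> = (2 * k + 2) * m" by (simp add: algebra_simps)
      also have "\<dots> \<le> b * m" using b2 by (intro mult_right_mono) auto
      finally have km: "(k + 1) * (m + 1) \<le> b * m" .
      \<comment> \<open>the bound from \<open>m\<close> is convex in \<open>m\<close>, hence worst at \<open>m = 1\<close> and \<open>m = b - 1\<close>\<close>
      define u where "u = (real m - 1) * (real b - 1 - real m)"
      have u: "u \<ge> 0" unfolding u_def using m mb by (intro mult_nonneg_nonneg) auto
      have my': "real b * y \<le> real m + 1" using my mb by simp
      \<comment> \<open>Multiplying this by \<open>b * m\<close> makes the bounds on
        \<open>b * y\<close> and \<open>m * z\<close> applicable to each term.\<close>
      have "real k + 1 \<le> k * (y + z) + y * z"
        using e bkr by (simp add: algebra_simps)
      then have "(real k + 1) * (real b * real m) \<le> (k * (y + z) + y * z) * (real b * real m)"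
        by (intro mult_right_mono) auto
      also have "\<dots> = real k * real m * (real b * y) + real k * real b * (real m * z)
          + (real b * y) * (real m * z)"
        by (simp add: algebra_simps)
      also have "\<dots> < real k * real m * (real m + 1) + real k * real b * 1 + (real m + 1) * 1"
      proof -
        have "real k * real m * (real b * y) \<le> real k * real m * (real m + 1)"
          using my' by (intro mult_left_mono) auto
        moreover have "real k * real b * (real m * z) < real k * real b * 1"
          using mz k b by (intro mult_strict_left_mono) auto
        moreover have "(real b * y) * (real m * z) \<le> (real m + 1) * 1"
          using my' mz y z by (intro mult_mono) auto
        ultimately show ?thesis by simp
      qed
      also have "\<dots> = real k * (real b * real m) - k * u + (real k + 1) * (m + 1)"
        by (simp add: u_def algebra_simps)
      finally have "real b * m < (real k + 1) * (m + 1) - k * u"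
        by (simp add: algebra_simps)
      moreover have "k * u \<ge> 0" using u by simp
      moreover have "real ((k + 1) * (m + 1)) \<le> real (b * m)" using km by (simp only: of_nat_le_iff)
      ultimately show False by (simp add: algebra_simps)
    qed
    have "real b < 4" using ub z k1 by simp
    then have "b < 4" by simp
    then have "b = 3" using bk k1 by simp
    then show ?thesis by (simp add: Gamma_set_def)
  qed
qed

subsection \<open>Initial prefixes\<close>

text \<open>The base 3 is not of the form \<open>k ^ 2 + j\<close> with
  \<open>1 \<le> j \<le> k\<close>. The convergent is \<open>126 / 251\<close> and the digit word
  \<open>1111122\<close> has value 1097, so \<open>X = 215\<close>; 251 is coprime to 3.\<close>

lemma good_prefix_base_3: "good_prefix 3 [1, 1, 125]"
proof -
  have "\<exists>P>0. 251 dvd ((3::int) ^ P - 1) * 215"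
  proof -
    have "coprime (3::nat) 251" by (simp add: coprime_iff_gcd_eq_1 gcd_nat.simps)
    then have "[3 ^ totient 251 = 1] (mod (251::nat))" by (rule euler_theorem)
    then have "[int 3 ^ totient 251 = 1] (mod (int 251))"
      by (metis cong_int_iff of_nat_1 of_nat_power)
    then have "251 dvd (3::int) ^ totient 251 - 1" by (simp add: cong_iff_dvd_diff)
    then have "251 dvd ((3::int) ^ totient 251 - 1) * 215" by (rule dvd_mult2)
    moreover have "totient 251 > 0" by simp
    ultimately show ?thesis by blast
  qed
  then show ?thesis
    by (simp add: good_prefix_def good_state_def Let_def digit_word_def base_digits_step digit_value_def)
qed

text \<open>
  Here \<open>B = b ^ N\<close> and \<open>k * m = j * B - R\<close> for the prefix \<open>k, m\<close>. As \<open>B\<close> grows, \<open>X / q\<close> tends to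
  \<open>(j * R - b) / (k * j)\<close> from below. When this limit is 1 the next step moves towards it, so there
  the first-order terms have to be compared.
\<close>

lemma start_asymptotics:
  fixes k j b R :: real
  assumes k: "k > 0" and j: "1 \<le> j" "j \<le> k" and b: "b = k\<^sup>2 + j" and R: "R > 1"
    and I: "1 \<le> j * R - b" "j * R - b = k * j \<or> j * R - b \<le> k * j - 1"
  defines "q \<equiv> \<lambda>B. j * B - (R - 1)"
  defines "X \<equiv> \<lambda>B. ((j * R - b) * q B - b * (R - 1)) / (k * j)"
  shows "\<forall>\<^sub>F B in at_top. b * k < q B \<and> 1 / b < X B / q B \<and> X B / q B < 1 \<and>
           X B / q B + b * B / (q B * X B) < 1 \<and> B / b \<le> (j * B - R) / k"
proof -
  define i where "i = j * R - b"
  define r where "r = R - 1"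
  have pos: "j > 0" "i > 0" "r > 0" using j I R by (simp_all add: i_def r_def)
  have b0: "b > 0" using k pos unfolding b by (intro add_nonneg_pos) auto
  have kj: "k * j < b" using j k pos unfolding b power2_eq_square
    by (smt (verit) mult_left_mono)
  have kj0: "k * j > 0" using k pos by simp
  have X: "X = (\<lambda>B. (i * q B - b * r) / (k * j))" and q: "q = (\<lambda>B. j * B - r)"
    by (simp_all add: X_def q_def i_def r_def)
  have qlim: "filterlim q at_top at_top" unfolding q using pos by real_asymp
  have ylim: "((\<lambda>B. X B / q B) \<longlongrightarrow> i / (k * j)) at_top"
    unfolding X q using pos k by (real_asymp simp: field_simps)
  have "1 / b < 1 / (k * j)" using kj kj0 b0 by (simp add: frac_less2)
  also have "\<dots> \<le> i / (k * j)" using I(1) kj0 by (intro divide_right_mono) (auto simp: i_def)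
  finally have "1 / b < i / (k * j)" .
  then have e2: "\<forall>\<^sub>F B in at_top. 1 / b < X B / q B" using order_tendstoD(1)[OF ylim] by blast
  have e1: "\<forall>\<^sub>F B in at_top. b * k < q B" using qlim by (simp add: filterlim_at_top_dense)
  \<comment> \<open>For \<open>B = b ^ N\<close> this says \<open>b ^ (N - 1) \<le> m\<close>, so
    \<open>m\<close> has no leading zero.\<close>
  have e5: "\<forall>\<^sub>F B in at_top. B / b \<le> (j * B - R) / k"
  proof -
    define d where "d = j / k - 1 / b"
    have "k * 1 \<le> k * j" "b * 1 \<le> b * j" using j k b0 by (intro mult_left_mono; simp)+
    then have "k < b * j" using kj by linarith
    then have "1 / b < j / k" using k b0 by (simp add: field_simps)
    then have "d > 0" by (simp add: d_def)
    then have "filterlim (\<lambda>B. B * d - R / k) at_top at_top" by real_asymp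
    then have "\<forall>\<^sub>F B in at_top. 0 \<le> B * d - R / k" unfolding filterlim_at_top by blast
    then show ?thesis by eventually_elim (simp add: d_def algebra_simps diff_divide_distrib)
  qed
  have e4: "\<forall>\<^sub>F B in at_top. X B / q B + b * B / (q B * X B) < 1"
    using I(2)
  proof
    assume "j * R - b \<le> k * j - 1"
    then have "i < k * j" by (simp add: i_def)
    then have "i / (k * j) < 1" using kj0 by simp
    moreover have "((\<lambda>B. b * B / (q B * X B)) \<longlongrightarrow> 0) at_top"
      unfolding X q using pos k by real_asymp
    with ylim have "((\<lambda>B. X B / q B + b * B / (q B * X B)) \<longlongrightarrow> i / (k * j) + 0) at_top"
      by (rule tendsto_add)
    ultimately show ?thesis using order_tendstoD(2) by fastforce
  next
    assume "j * R - b = k * j"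
    then have i: "i = k * j" by (simp add: i_def)
    \<comment> \<open>Now \<open>X B\<close> equals \<open>q B - b * r / (k * j)\<close>, so the
      claim amounts to \<open>k * j * B < r * X B\<close>. The leading coefficients are
      \<open>k * j\<close> and \<open>r * j\<close>, and this identity gives
      \<open>r > k\<close>.\<close>
    have "j * r = k\<^sup>2 + k * j" using i by (simp add: i_def r_def b algebra_simps)
    then have "j * r > j * k" using k by (simp add: mult.commute)
    then have rk: "r > k" using pos by simp
    define c where "c = r - k"
    have c: "c > 0" using rk by (simp add: c_def)
    have "filterlim (\<lambda>B. j * c * B - r * (r + b * r / (k * j))) at_top at_top"
      using c pos by real_asymp
    then have "\<forall>\<^sub>F B in at_top. 0 < j * c * B - r * (r + b * r / (k * j))"
      unfolding filterlim_at_top_dense by blast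
    then show ?thesis using e1 e2
    proof eventually_elim
      case (elim B)
      have q0: "q B > 0" using elim(2) b0 k by (smt (verit) mult_pos_pos)
      have "X B / q B > 0" using elim(3) b0 by (smt (verit) divide_pos_pos)
      then have X0: "X B > 0" using q0 by (simp add: zero_less_divide_iff)
      have XB: "X B = q B - b * r / (k * j)" 
        unfolding X i diff_divide_distrib using k pos by simp
      have "r * X B - k * j * B = j * c * B - r * (r + b * r / (k * j))"
        unfolding XB unfolding q c_def by (simp add: algebra_simps)
      then have "k * j * B < r * X B" using elim(1) by linarith
      then have "b * (k * j * B) < b * (r * X B)" using b0 by simp
      then have "b * B / X B < b * r / (k * j)"
        using X0 kj0 by (simp add: field_simps)
      then have "X B + b * B / X B < q B" using XB by linarith
      then have "(X B + b * B / X B) / q B < 1" using q0 by simp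
      then show ?case by (simp add: add_divide_distrib mult.commute)
    qed
  qed
  have e3: "\<forall>\<^sub>F B in at_top. X B / q B < 1"
    using e1 e2
  proof eventually_elim
    case (elim B)
    have q0: "q B > 0" using elim(1) b0 k by (smt (verit) mult_pos_pos)
    have "i * q B \<le> k * j * q B" using I(2) q0 by (intro mult_right_mono) (auto simp: i_def)
    moreover have "b * r > 0" using b0 pos by simp
    ultimately have "i * q B - b * r < k * j * q B" by linarith
    then have "X B < q B" unfolding X using kj0 by (simp add: divide_less_eq mult.commute)
    then show ?case using q0 by simp
  qed
  show ?thesis using e1 e2 e3 e4 e5 by eventually_elim blast
qed

text \<open>In \<open>k * m = j * b ^ N - R\<close> the residue of \<open>R\<close> modulo
  \<open>k\<close> is forced, and \<open>1 \<le> j * R - b \<le> k * j\<close> leaves a window of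
  length \<open>k\<close>, so a suitable \<open>R\<close> always exists.\<close>

lemma good_prefix_square_plus:
  fixes k j b :: nat
  assumes j: "1 \<le> j" "j \<le> k" and b: "b = k\<^sup>2 + j"
  shows "\<exists>m>0. good_prefix b [k, m]"
proof -
  have k: "k > 0" using j by simp
  have kk: "k * 1 \<le> k\<^sup>2" unfolding power2_eq_square using k by (intro mult_left_mono) auto
  then have b2: "b \<ge> 2" and kb: "k < b" using j b by auto
  define E :: "int \<Rightarrow> real \<Rightarrow> bool" where
    "E = (\<lambda>R B. let q = real j * B - (of_int R - 1);
                 X = ((real j * of_int R - real b) * q - real b * (of_int R - 1)) / (real k * real j)
       in real b * real k < q \<and> 1 / b < X / q \<and> X / q < 1 \<and>
          X / q + real b * B / (q * X) < 1 \<and> B / real b \<le> (real j * B - of_int R) / real k)"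
  \<comment> \<open>\<open>R\<close> changes with \<open>N\<close>, so one threshold has to serve
    all its possible values; finiteness of \<open>S\<close> provides it.\<close>
  define S where "S = {R::int. 1 < R \<and> R \<le> int b + k * j \<and>
      1 \<le> int j * R - b \<and> int j * R - b \<le> int k * j}"
  have "finite S" by (rule finite_subset[of _ "{1..int b + k * j}"]) (auto simp: S_def)
  moreover have "\<forall>\<^sub>F B in at_top. E R B" if "R \<in> S" for R
  proof -
    have R: "1 < R" "1 \<le> int j * R - b" "int j * R - b \<le> int k * j" using that by (auto simp: S_def)
    have "real_of_int 1 \<le> of_int (int j * R - b)" using R(2) by (simp only: of_int_le_iff)
    then have 1: "1 \<le> real j * of_int R - b" by simp
    have "int j * R - b = int k * j \<or> int j * R - b \<le> int k * j - 1" using R(3) by linarith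
    then have "real_of_int (int j * R - b) = of_int (int k * j) \<or>
        real_of_int (int j * R - b) \<le> of_int (int k * j - 1)"
      by (simp only: of_int_le_iff of_int_eq_iff)
    then have 2: "real j * of_int R - b = real k * j \<or> real j * of_int R - b \<le> real k * j - 1"
      by simp
    show ?thesis
      unfolding E_def Let_def
      using start_asymptotics[of k j b "of_int R", OF _ _ _ _ _ 1 2] k j b R(1) by simp
  qed
  ultimately have "\<forall>\<^sub>F B in at_top. \<forall>R\<in>S. E R B" by (simp add: eventually_ball_finite)
  moreover have "filterlim (\<lambda>N. real b ^ N) at_top sequentially"
  proof -
    define c where "c = real b"
    have "c > 1" using b2 by (simp add: c_def)
    then show ?thesis unfolding c_def[symmetric] by real_asymp
  qed
  ultimately have "\<forall>\<^sub>F N in sequentially. \<forall>R\<in>S. E R (real b ^ N)"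
    by (rule eventually_compose_filterlim)
  then obtain N0 where N0: "\<And>N R. N \<ge> N0 \<Longrightarrow> R \<in> S \<Longrightarrow> E R (real b ^ N)"
    unfolding eventually_sequentially by blast
  \<comment> \<open>The summands \<open>b + k * j\<close> make \<open>N\<close> exceed every
    \<open>R\<close> in \<open>S\<close>, as the periodicity lemma requires for
    \<open>D = R - 1\<close>.\<close>
  define N where "N = N0 + b + k * j + 1"
  define t where "t = int b div j"
  \<comment> \<open>the unique \<open>R\<close> in \<open>(b / j, b / j + k]\<close> congruent to \<open>j * b ^ N\<close> modulo \<open>k\<close>\<close>
  define R where "R = t + 1 + (int j * int b ^ N - t - 1) mod k"
  have mod: "0 \<le> (int j * int b ^ N - t - 1) mod k" "(int j * int b ^ N - t - 1) mod k < k"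
    using k by simp_all
  have tj: "int j * t \<le> b" "int b < int j * (t + 1)"
  proof -
    have "int b = int j * t + int b mod j" by (simp add: t_def)
    moreover have "0 \<le> int b mod j" "int b mod j < j" using j by simp_all
    ultimately show "int j * t \<le> b" "int b < int j * (t + 1)" by (simp_all add: algebra_simps)
  qed
  have RS: "R \<in> S"
  proof -
    have "int j * (t + 1) \<le> int j * R" using mod(1) by (intro mult_left_mono) (auto simp: R_def)
    then have l: "1 \<le> int j * R - b" using tj(2) by linarith
    have "int j * R \<le> int j * (t + k)" using mod(2) by (intro mult_left_mono) (auto simp: R_def)
    then have u: "int j * R - b \<le> int k * j" using tj(1) by (simp add: algebra_simps)
    have "int b \<ge> int j" using b by simp
    then have jR: "int j * R > int j * 1" using l by linarith
    then have R1: "1 < R" using j by (simp add: mult_less_cancel_left)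
    have "1 * R \<le> int j * R" using j R1 by (intro mult_right_mono) auto
    then have "R \<le> int b + k * j" using u by simp
    then show ?thesis using R1 l u by (simp add: S_def)
  qed
  then have R1: "1 < R" and RN: "R < int N" by (auto simp: S_def N_def)
  define B where "B = real b ^ N"
  have EB: "E R B" unfolding B_def by (rule N0[OF _ RS]) (simp add: N_def)
  have B: "B > 0" using b2 by (simp add: B_def)
  have "int k dvd int j * int b ^ N - R"
    using dvd_minus_mod[of "int k" "int j * int b ^ N - t - 1"] by (simp add: R_def algebra_simps)
  then obtain mi where mi: "int j * int b ^ N - R = int k * mi" by blast
  then have "real_of_int (int j * int b ^ N - R) = of_int (int k * mi)" by simp
  then have mr: "real j * B - of_int R = real k * of_int mi" by (simp add: B_def)
  then have mr': "(real j * B - of_int R) / k = of_int mi" using k by simp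
  have Bm: "B / b \<le> of_int mi" using EB mr' by (simp add: E_def Let_def)
  have "B / b > 0" using B b2 by simp
  then have "mi > 0" using Bm by simp
  then obtain m where m: "mi = int m" "m > 0" by (metis zero_less_imp_eq_int)
  have lo: "b ^ (N - 1) \<le> m"
  proof -
    have "b * b ^ (N - 1) = b ^ N" by (simp add: N_def)
    then have "real b * real b ^ (N - 1) = B" unfolding B_def by (metis of_nat_mult of_nat_power)
    then have "B / b = real (b ^ (N - 1))" using b2 by (auto simp: field_simps)
    then have "real (b ^ (N - 1)) \<le> real m" using Bm m by simp
    then show ?thesis by (simp only: of_nat_le_iff)
  qed
  have hi: "m < b ^ N"
  proof -
    have "int k * int m < int j * int b ^ N" using mi m R1 by simp
    also have "\<dots> \<le> int k * int b ^ N" using j by (intro mult_right_mono) auto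
    finally have "int m < int (b ^ N)" using k by (simp add: mult_less_cancel_left)
    then show ?thesis by (simp only: of_nat_less_iff)
  qed
  have lenm: "length (base_digits b m) = N"
    using length_base_digits[OF b2, of "N - 1" m] lo hi by (simp add: N_def)
  have dk: "base_digits b k = [k]" using base_digits_step[OF b2 k] kb by simp
  define q where "q = int m * k + 1"
  define e where "e = int k * int b ^ N + m"
  define X where "X = int b ^ (1 + N) * m - e * q"
  \<comment> \<open>This is the shape that \<open>periodic_of_power_minus\<close> expects, with
    \<open>j\<close> in the role of its \<open>X\<close>.\<close>
  have q: "q = int b ^ N * j - (R - 1)" using mi m by (simp add: q_def algebra_simps)
  have qr: "of_int q = real j * B - (of_int R - 1)" unfolding q by (simp add: B_def algebra_simps)
  \<comment> \<open>Substituting \<open>m * k = q - 1\<close> and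
    \<open>j * b ^ N = q + R - 1\<close> eliminates \<open>m\<close> and yields the formula inside
    \<open>E\<close>.\<close>
  have Xkj: "X * (int k * j) = (int j * R - b) * q - b * (R - 1)"
  proof -
    have XN: "X = int b ^ N * (int m * j - k) - m * q"
      unfolding X_def e_def q_def b by (simp add: algebra_simps power2_eq_square)
    have "X * (int k * j) = int j * int b ^ N * (int j * (int m * k) - int k ^ 2) - int j * (int m * k) * q"
      unfolding XN by (simp add: algebra_simps power2_eq_square)
    also have "int j * int b ^ N = q + R - 1" using q by simp
    also have "int m * k = q - 1" by (simp add: q_def)
    finally show ?thesis unfolding b by (simp add: algebra_simps power2_eq_square)
  qed
  then have "real_of_int (X * (int k * j)) = of_int ((int j * R - b) * q - b * (R - 1))" by (rule arg_cong)
  then have "of_int X * (real k * j) = (real j * of_int R - b) * of_int q - b * (of_int R - 1)" by simp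
  then have Xr: "of_int X = ((real j * of_int R - b) * of_int q - b * (of_int R - 1)) / (real k * j)"
    using k j by (simp add: eq_divide_eq)
  have con: "real b * k < of_int q" "1 / b < of_int X / real_of_int q" "of_int X / real_of_int q < 1"
     "of_int X / of_int q + b * B / (of_int q * real_of_int X) < 1"
    using EB unfolding E_def Let_def qr[symmetric] by (simp_all add: Xr)
  have q0: "q > 0" using q_def by simp
  have "real b * k * (1 / b) < of_int q * (of_int X / of_int q)"
    using con(1,2) k b2 q0 by (intro mult_strict_mono) auto
  then have kX: "int k < X" using q0 b2 by simp
  have "\<exists>P>0. q dvd (int b ^ P - 1) * X"
  proof -
    obtain P where P: "P > 0" "q dvd (int b ^ P - 1) * int b ^ (1 + N)"
      using periodic_of_power_minus[OF b2 _ q0 q, of "1 + N"] R1 RN by auto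
    have "(int b ^ P - 1) * X = (int b ^ P - 1) * int b ^ (1 + N) * m - (int b ^ P - 1) * e * q"
      unfolding X_def by (simp add: algebra_simps)
    then show ?thesis using P by (metis dvd_diff dvd_mult2 dvd_triv_right)
  qed
  \<comment> \<open>The determinant is \<open>1\<close> here, so the limit position lies above
    \<open>X / q\<close> and inherits its lower bound.\<close>
  moreover have "1 / b < of_int X / of_int q + b * B / (of_int q * real_of_int X)"
  proof -
    have "0 \<le> b * B / (of_int q * real_of_int X)" using B q0 kX by simp
    then show ?thesis using con(2) by linarith
  qed
  ultimately have "good_state b (int m) 1 q (int k) e (1 + N)"
    unfolding good_state_def Let_def X_def[symmetric]
    using con kX by (simp add: q_def B_def)
  moreover have "digit_word b [k, m] = [k] @ base_digits b m" by (simp add: digit_word_def dk)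
  moreover have "digit_value b [k] = k" using digit_value_snoc[of b "[]" k] by simp
  ultimately have "good_prefix b [k, m]"
    using lenm digit_value_base_digits[OF b2, of m]
    by (simp add: good_prefix_def digit_value_append q_def e_def del: append_Cons append_Nil)
  then show ?thesis using m by blast
qed

theorem theorem1p2:
  fixes b :: nat
  assumes "b \<ge> 2"
  shows "(trott_numbers b \<noteq> {} \<longleftrightarrow> b \<in> Gamma_set)
       \<and> (trott_numbers b \<noteq> {} \<longrightarrow> uncountable (trott_numbers b))"
proof -
  have "uncountable (trott_numbers b)" if G: "b \<in> Gamma_set"
  proof (cases "b = 3")
    case True
    then show ?thesis
      using uncountable_trott_numbers_if_good_prefix[OF assms, of "[1, 1, 125]"] good_prefix_base_3
      by simp
  next
    case False
    then obtain k where k: "k\<^sup>2 + 1 \<le> b" "b \<le> k\<^sup>2 + k" using G by (auto simp: Gamma_set_def)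
    then have "k \<ge> 1" by (cases "k = 0") auto
    from k obtain m where "m > 0" "good_prefix b [k, m]"
      using good_prefix_square_plus[of "b - k\<^sup>2" k b] by auto
    then show ?thesis
      using uncountable_trott_numbers_if_good_prefix[OF assms, of "[k, m]"] \<open>k \<ge> 1\<close> by simp
  qed
  moreover have "b \<in> Gamma_set" if "trott_numbers b \<noteq> {}"
    using that Gamma_set_if_trott_nonempty[OF assms] by blast
  moreover have "trott_numbers b \<noteq> {}" if "uncountable (trott_numbers b)"
    using that by auto
  ultimately show ?thesis by blast
qed

end
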